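(* Let $G$ be a group and $I,\Lambda$ sets. Given a $\Lambda\times I$ matrix $P=(p_{\lambda i})$ with entries from the group $G$, one can define a cross-connection $\Gamma$ (from $\mathcal{R}(S)$ to $N^\ast\mathcal{L}(S)$, where $S=\mathscr{M}[G;I,\Lambda;P]$) such that the cross-connection semigroup $\tilde S\Gamma$ is isomorphic to the completely simple semigroup $S=\mathscr{M}[G;I,\Lambda;P]$.
   Context: $S=\mathscr{M}[G;I,\Lambda;P]=G\times I\times\Lambda$ is the Rees matrix semigroup with product $(a,i,\lambda)(b,j,\mu)=(ap_{\lambda j}b,i,\mu)$. Composition of maps is written left to right. $\mathcal{L}(S)$ is the category of principal left ideals of $S$: its objects are $\bar\lambda=G\times I\times\{\lambda\}$ ($\lambda\in\Lambda$), and its morphisms $\bar\lambda_1\to\bar\lambda_2$ are the maps $\rho(g):(h,i,\lambda_1)\mapsto(hg,i,\lambda_2)$, $g\in G$. $\mathcal{R}(S)$ is the category of principal right ideals: its objects are $\bar i=G\times\{i\}\times\Lambda$ ($i\in I$), and its morphisms $\bar i_1\to\bar i_2$ are the maps $\kappa(g):(h,i_1,\lambda)\mapsto(gh,i_2,\lambda)$, $g\in G$. In both categories all morphisms are isomorphisms and all inclusions are identities. For $\mathcal{C}$ either of these categories, a normal cone $\gamma$ with vertex $c_\gamma$ is a family of morphisms $\gamma(c):c\to c_\gamma$, one for each object $c$; $T\mathcal{C}$ is the semigroup of normal cones with $(\gamma\ast\sigma)(c)=\gamma(c)\sigma(c_\gamma)$; for $f:c_\gamma\to d$, $\gamma\ast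 f$ is the cone $c\mapsto\gamma(c)f$. $H(\gamma;-):\mathcal{C}\to\mathbf{Set}$ is the functor $H(\gamma;c)=\{\gamma\ast f:f\in\mathcal{C}(c_\gamma,c)\}$, $H(\gamma;g):\gamma\ast f\mapsto\gamma\ast(fg)$. The normal dual $N^\ast\mathcal{C}$ is the full subcategory of the category of functors $\mathcal{C}\to\mathbf{Set}$ on the objects $H(\epsilon;-)$, $\epsilon$ an idempotent of $T\mathcal{C}$. $MH(\gamma;-)=\{c:\gamma(c)\text{ is an isomorphism}\}$. A local isomorphism is an inclusion-preserving, fully faithful functor $F$ whose restriction to each full subcategory $\langle c\rangle$ of subobjects of $c$ is an isomorphism onto $\langle F(c)\rangle$. A cross-connection $\Gamma:\mathcal{D}\to N^\ast\mathcal{C}$ is a local isomorphism such that every object $c$ of $\mathcal{C}$ lies in $M\Gamma(d)$ for some object $d$ of $\mathcal{D}$. It determines the bifunctor $\Gamma(-,-):\mathcal{C}\times\mathcal{D}\to\mathbf{Set}$ with $\Gamma(c,d)=\Gamma(d)(c)$ and $\Gamma(f,g)=(\Gamma(d)(f))(\Gamma(g)(c'))$ for $(f,g):(c,d)\to(c',d')$. In Nambooripad's theory, to a cross-connection $\Gamma$ there is associated a dual cross-connection $\Delta:\mathcal{C}\to N^\ast\mathcal{D}$, with bifunctor $\Delta(c,d)=\Delta(c)(d)$, $\Delta(f,g)=(\Delta(c)(g))(\Delta(f)(d'))$, together with a natural isomorphism $\chi_\Gamma:\Gamma(-,-)\to\Delta(-,-)$ (the duality), whose components $\chi_\Gamma(c,d):\Gamma(c,d)\to\Delta(c,d)$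 are bijections. Put $U\Gamma=\bigcup\Gamma(c,d)\subseteq T\mathcal{C}$ and $U\Delta=\bigcup\Delta(c,d)\subseteq T\mathcal{D}$ (unions over all pairs of objects). A cone $\gamma\in U\Gamma$ is linked to $\delta\in U\Delta$ if for some $(c,d)$, $\gamma\in\Gamma(c,d)$ and $\delta=\chi_\Gamma(c,d)(\gamma)$. The cross-connection semigroup is $\tilde S\Gamma=\{(\gamma,\delta)\in U\Gamma\times U\Delta:\gamma\text{ is linked to }\delta\}$ with $(\gamma,\delta)\circ(\gamma',\delta')=(\gamma\ast\gamma',\delta'\ast\delta)$. Here $\mathcal{C}=\mathcal{L}(S)$ and $\mathcal{D}=\mathcal{R}(S)$. *)

theory Defs
  imports "HOL-Algebra.Group"
begin

section \<open>Semigroups\<close>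

text \<open>The record \<open>monoid\<close> of the library carries a unit; here only a product is wanted.\<close>

record 'a sgrp = "'a partial_object" +
  smult :: "'a \<Rightarrow> 'a \<Rightarrow> 'a"

definition sgrp_idempotents :: "'a sgrp \<Rightarrow> 'a set" where
  "sgrp_idempotents S = {x \<in> carrier S. smult S x x = x}"

definition sgrp_isomorphic :: "'a sgrp \<Rightarrow> 'b sgrp \<Rightarrow> bool" where
  "sgrp_isomorphic S T \<longleftrightarrow>
     (\<exists>\<phi>. bij_betw \<phi> (carrier S) (carrier T) \<and>
          (\<forall>x\<in>carrier S. \<forall>y\<in>carrier S. \<phi> (smult S x y) = smult T (\<phi> x) (\<phi> y)))"

definition rees_matrix ::
  "'g monoid \<Rightarrow> 'i set \<Rightarrow> 'l set \<Rightarrow> ('l \<Rightarrow> 'i \<Rightarrow> 'g) \<Rightarrow> ('g \<times> 'i \<times> 'l) sgrp" where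
  "rees_matrix G I \<Lambda> P =
     \<lparr>carrier = carrier G \<times> I \<times> \<Lambda>,
      smult = (\<lambda>(a, i, l) (b, j, m). (a \<otimes>\<^bsub>G\<^esub> P l j \<otimes>\<^bsub>G\<^esub> b, i, m))\<rparr>"


section \<open>Categories with subobjects\<close>

text \<open>
  \<open>Cmp C f g\<close> is the composite written \<open>f g\<close>, that is, first \<open>f\<close>, then \<open>g\<close>.
  \<open>Inc C\<close> is the set of those arrows that are inclusions of subobjects.
\<close>

record ('o, 'm) scat =
  Obj :: "'o set"
  Arr :: "'m set"
  Dom :: "'m \<Rightarrow> 'o"
  Cod :: "'m \<Rightarrow> 'o"
  Idt :: "'o \<Rightarrow> 'm"
  Cmp :: "'m \<Rightarrow> 'm \<Rightarrow> 'm"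
  Inc :: "'m set"

definition Hom :: "('o, 'm) scat \<Rightarrow> 'o \<Rightarrow> 'o \<Rightarrow> 'm set" where
  "Hom C a b = {f \<in> Arr C. Dom C f = a \<and> Cod C f = b}"

definition iso_arrow :: "('o, 'm) scat \<Rightarrow> 'm \<Rightarrow> bool" where
  "iso_arrow C f \<longleftrightarrow> f \<in> Arr C \<and>
     (\<exists>g \<in> Hom C (Cod C f) (Dom C f).
        Cmp C f g = Idt C (Dom C f) \<and> Cmp C g f = Idt C (Cod C f))"

definition full_subcat :: "('o, 'm) scat \<Rightarrow> 'o set \<Rightarrow> ('o, 'm) scat" where
  "full_subcat C A = C
     \<lparr>Obj := A,
      Arr := {f \<in> Arr C. Dom C f \<in> A \<and> Cod C f \<in> A},
      Inc := {f \<in> Inc C. Dom C f \<in> A \<and> Cod C f \<in> A}\<rparr>"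

definition subobjects_cat :: "('o, 'm) scat \<Rightarrow> 'o \<Rightarrow> ('o, 'm) scat" where
  "subobjects_cat C c = full_subcat C {b \<in> Obj C. \<exists>j \<in> Inc C. Dom C j = b \<and> Cod C j = c}"


subsection \<open>Functors\<close>

record ('o, 'm, 'p, 'n) func =
  FOb :: "'o \<Rightarrow> 'p"
  FAr :: "'m \<Rightarrow> 'n"

definition is_functor ::
  "('o, 'm) scat \<Rightarrow> ('p, 'n) scat \<Rightarrow> ('o, 'm, 'p, 'n) func \<Rightarrow> bool" where
  "is_functor C D F \<longleftrightarrow>
     (\<forall>a \<in> Obj C. FOb F a \<in> Obj D) \<and>
     (\<forall>f \<in> Arr C. FAr F f \<in> Hom D (FOb F (Dom C f)) (FOb F (Cod C f))) \<and>
     (\<forall>a \<in> Obj C. FAr F (Idt C a) = Idt D (FOb F a)) \<and>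
     (\<forall>f \<in> Arr C. \<forall>g \<in> Arr C. Cod C f = Dom C g \<longrightarrow>
        FAr F (Cmp C f g) = Cmp D (FAr F f) (FAr F g))"

definition inclusion_preserving ::
  "('o, 'm) scat \<Rightarrow> ('p, 'n) scat \<Rightarrow> ('o, 'm, 'p, 'n) func \<Rightarrow> bool" where
  "inclusion_preserving C D F \<longleftrightarrow> (\<forall>j \<in> Inc C. FAr F j \<in> Inc D)"

definition fully_faithful ::
  "('o, 'm) scat \<Rightarrow> ('p, 'n) scat \<Rightarrow> ('o, 'm, 'p, 'n) func \<Rightarrow> bool" where
  "fully_faithful C D F \<longleftrightarrow>
     (\<forall>a \<in> Obj C. \<forall>b \<in> Obj C. bij_betw (FAr F) (Hom C a b) (Hom D (FOb F a) (FOb F b)))"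

definition is_cat_iso ::
  "('o, 'm) scat \<Rightarrow> ('p, 'n) scat \<Rightarrow> ('o, 'm, 'p, 'n) func \<Rightarrow> bool" where
  "is_cat_iso C D F \<longleftrightarrow> is_functor C D F \<and>
     bij_betw (FOb F) (Obj C) (Obj D) \<and> bij_betw (FAr F) (Arr C) (Arr D)"

definition local_isomorphism ::
  "('o, 'm) scat \<Rightarrow> ('p, 'n) scat \<Rightarrow> ('o, 'm, 'p, 'n) func \<Rightarrow> bool" where
  "local_isomorphism C D F \<longleftrightarrow>
     is_functor C D F \<and> inclusion_preserving C D F \<and> fully_faithful C D F \<and>
     (\<forall>c \<in> Obj C. is_cat_iso (subobjects_cat C c) (subobjects_cat D (FOb F c)) F)"


subsection \<open>Set-valued functors and natural transformations\<close>

text \<open>A set-valued functor whose values are subsets of the type \<open>'x\<close>.\<close>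

type_synonym ('o, 'm, 'x) setfunc = "('o, 'm, 'x set, 'x \<Rightarrow> 'x) func"

text \<open>
  A natural transformation as an arrow: source functor, family of components, target functor.
  Components are extensional, so equality of arrows is equality of natural transformations.
\<close>

type_synonym ('o, 'm, 'x) natarr =
  "('o, 'm, 'x) setfunc \<times> ('o \<Rightarrow> 'x \<Rightarrow> 'x) \<times> ('o, 'm, 'x) setfunc"

definition component :: "('o, 'm, 'x) natarr \<Rightarrow> 'o \<Rightarrow> 'x \<Rightarrow> 'x" where
  "component t c = fst (snd t) c"

definition nat_trans ::
  "('o, 'm) scat \<Rightarrow> ('o, 'm, 'x) setfunc \<Rightarrow> ('o, 'm, 'x) setfunc \<Rightarrow> ('o \<Rightarrow> 'x \<Rightarrow> 'x) set" where
  "nat_trans C F F' =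
     {\<eta> \<in> (\<Pi>\<^sub>E c \<in> Obj C. (FOb F c \<rightarrow>\<^sub>E FOb F' c)).
        \<forall>f \<in> Arr C. \<forall>x \<in> FOb F (Dom C f).
          FAr F' f (\<eta> (Dom C f) x) = \<eta> (Cod C f) (FAr F f x)}"

text \<open>
  The full subcategory on the set \<open>\<F>\<close> of the category of functors from \<open>C\<close> to sets; its
  inclusions are the inclusions of subfunctors.
\<close>

definition functor_cat ::
  "('o, 'm) scat \<Rightarrow> ('o, 'm, 'x) setfunc set \<Rightarrow>
     (('o, 'm, 'x) setfunc, ('o, 'm, 'x) natarr) scat" where
  "functor_cat C \<F> =
     \<lparr>Obj = \<F>,
      Arr = {(F, \<eta>, F'). F \<in> \<F> \<and> F' \<in> \<F> \<and> \<eta> \<in> nat_trans C F F'},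
      Dom = (\<lambda>(F, \<eta>, F'). F),
      Cod = (\<lambda>(F, \<eta>, F'). F'),
      Idt = (\<lambda>F. (F, \<lambda>c\<in>Obj C. \<lambda>x\<in>FOb F c. x, F)),
      Cmp = (\<lambda>(F, \<eta>, F') (K, \<theta>, K'). (F, \<lambda>c\<in>Obj C. compose (FOb F c) (\<theta> c) (\<eta> c), K')),
      Inc = {(F, \<eta>, F'). F \<in> \<F> \<and> F' \<in> \<F> \<and> \<eta> \<in> nat_trans C F F' \<and>
                (\<forall>c \<in> Obj C. FOb F c \<subseteq> FOb F' c \<and> (\<forall>x \<in> FOb F c. \<eta> c x = x))}\<rparr>"


section \<open>Normal cones and the normal dual\<close>

text \<open>
  The definitions of this section are for categories in which every arrow is an isomorphism and
  every inclusion an identity.  In a general normal category a normal cone must also be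
  compatible with inclusions and have an isomorphism among its components, and the product uses
  an epimorphic component; here the two conditions hold automatically and the component is the
  arrow itself.
\<close>

record ('o, 'm) cone =
  vertex :: 'o
  leg :: "'o \<Rightarrow> 'm"

definition normal_cones :: "('o, 'm) scat \<Rightarrow> ('o, 'm) cone set" where
  "normal_cones C =
     {\<gamma>. vertex \<gamma> \<in> Obj C \<and> leg \<gamma> \<in> (\<Pi>\<^sub>E c \<in> Obj C. Hom C c (vertex \<gamma>))}"

definition cone_mult ::
  "('o, 'm) scat \<Rightarrow> ('o, 'm) cone \<Rightarrow> ('o, 'm) cone \<Rightarrow> ('o, 'm) cone" where
  "cone_mult C \<gamma> \<sigma> =
     \<lparr>vertex = vertex \<sigma>, leg = (\<lambda>c\<in>Obj C. Cmp C (leg \<gamma> c) (leg \<sigma> (vertex \<gamma>)))\<rparr>"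

definition cone_act :: "('o, 'm) scat \<Rightarrow> ('o, 'm) cone \<Rightarrow> 'm \<Rightarrow> ('o, 'm) cone" where
  "cone_act C \<gamma> f = \<lparr>vertex = Cod C f, leg = (\<lambda>c\<in>Obj C. Cmp C (leg \<gamma> c) f)\<rparr>"

definition cone_semigroup :: "('o, 'm) scat \<Rightarrow> ('o, 'm) cone sgrp" where
  "cone_semigroup C = \<lparr>carrier = normal_cones C, smult = cone_mult C\<rparr>"

definition idempotent_cones :: "('o, 'm) scat \<Rightarrow> ('o, 'm) cone set" where
  "idempotent_cones C = sgrp_idempotents (cone_semigroup C)"

definition H_functor ::
  "('o, 'm) scat \<Rightarrow> ('o, 'm) cone \<Rightarrow> ('o, 'm, ('o, 'm) cone) setfunc" where
  "H_functor C \<gamma> =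
     \<lparr>FOb = (\<lambda>c\<in>Obj C. cone_act C \<gamma> ` Hom C (vertex \<gamma>) c),
      FAr = (\<lambda>g\<in>Arr C. \<lambda>\<sigma>\<in>cone_act C \<gamma> ` Hom C (vertex \<gamma>) (Dom C g).
               THE \<tau>. \<exists>f \<in> Hom C (vertex \<gamma>) (Dom C g).
                 \<sigma> = cone_act C \<gamma> f \<and> \<tau> = cone_act C \<gamma> (Cmp C f g))\<rparr>"

definition normal_dual ::
  "('o, 'm) scat \<Rightarrow>
     (('o, 'm, ('o, 'm) cone) setfunc, ('o, 'm, ('o, 'm) cone) natarr) scat" where
  "normal_dual C = functor_cat C (H_functor C ` idempotent_cones C)"

definition M_set :: "('o, 'm) scat \<Rightarrow> ('o, 'm, ('o, 'm) cone) setfunc \<Rightarrow> 'o set" where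
  "M_set C F =
     {c \<in> Obj C. \<exists>\<gamma> \<in> idempotent_cones C. F = H_functor C \<gamma> \<and> iso_arrow C (leg \<gamma> c)}"


section \<open>Cross-connections and their duals\<close>

text \<open>Throughout, \<open>\<Gamma>\<close> goes from \<open>D\<close> to the normal dual of \<open>C\<close>.\<close>

type_synonym ('p, 'n, 'o, 'm) cc =
  "('p, 'n, ('o, 'm, ('o, 'm) cone) setfunc, ('o, 'm, ('o, 'm) cone) natarr) func"

definition cross_connection ::
  "('p, 'n) scat \<Rightarrow> ('o, 'm) scat \<Rightarrow> ('p, 'n, 'o, 'm) cc \<Rightarrow> bool" where
  "cross_connection D C \<Gamma> \<longleftrightarrow>
     local_isomorphism D (normal_dual C) \<Gamma> \<and>
     (\<forall>c \<in> Obj C. \<exists>d \<in> Obj D. c \<in> M_set C (FOb \<Gamma> d))"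

definition bifunctor_ob :: "('p, 'n, 'o, 'm) cc \<Rightarrow> 'o \<Rightarrow> 'p \<Rightarrow> ('o, 'm) cone set" where
  "bifunctor_ob \<Gamma> c d = FOb (FOb \<Gamma> d) c"

definition bifunctor_ar ::
  "('p, 'n) scat \<Rightarrow> ('o, 'm) scat \<Rightarrow> ('p, 'n, 'o, 'm) cc \<Rightarrow>
     'm \<Rightarrow> 'n \<Rightarrow> ('o, 'm) cone \<Rightarrow> ('o, 'm) cone" where
  "bifunctor_ar D C \<Gamma> f g x =
     component (FAr \<Gamma> g) (Cod C f) (FAr (FOb \<Gamma> (Dom D g)) f x)"

text \<open>
  The dual of \<open>\<Gamma>\<close> and the duality are those of Nambooripad's theory, built as follows.  Let
  \<open>E\<close> be the set of pairs \<open>(c, d)\<close> with \<open>c \<in> M\<Gamma>(d)\<close>.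

  For \<open>(c, d) \<in> E\<close>, \<open>\<gamma>(c, d)\<close> is the unique idempotent cone with vertex \<open>c\<close> and
  \<open>H(\<gamma>(c, d); -) = \<Gamma>(d)\<close>.

  For \<open>(c, d), (c', d') \<in> E\<close> and \<open>f : c' \<rightarrow> c\<close>, the transpose of \<open>f\<close> is the unique
  \<open>f\<^sup>* : d \<rightarrow> d'\<close> such that the natural transformation \<open>\<Gamma>(f\<^sup>*)\<close> corresponds to
  \<open>C(f, -) : C(c, -) \<rightarrow> C(c', -)\<close> under the natural isomorphisms \<open>\<gamma>(c, d) * k \<mapsto> k\<close> from
  \<open>\<Gamma>(d)\<close> to \<open>C(c, -)\<close> and \<open>\<gamma>(c', d') * k \<mapsto> k\<close> from \<open>\<Gamma>(d')\<close> to \<open>C(c', -)\<close>.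

  For \<open>(c, d) \<in> E\<close>, \<open>\<gamma>\<^sup>*(c, d)\<close> is the cone in \<open>D\<close> with vertex \<open>d\<close> whose component at
  \<open>d'\<close> is the transpose \<open>d' \<rightarrow> d\<close> of \<open>\<gamma>(c', d')(c) : c \<rightarrow> c'\<close>, for any \<open>c'\<close> with
  \<open>(c', d') \<in> E\<close>.

  Then \<open>\<Delta>(c) = H(\<gamma>\<^sup>*(c, d); -)\<close>; for \<open>f : c \<rightarrow> c'\<close>, \<open>\<Delta>(f)\<close> corresponds to
  \<open>D(f\<^sup>*, -)\<close>; and \<open>\<chi>(c, d)\<close> maps \<open>\<gamma>(c', d) * f\<close> to \<open>\<gamma>\<^sup>*(c, d') * f\<^sup>*\<close>.
\<close>

definition cc_pairs ::
  "('p, 'n) scat \<Rightarrow> ('o, 'm) scat \<Rightarrow> ('p, 'n, 'o, 'm) cc \<Rightarrow> ('o \<times> 'p) set" where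
  "cc_pairs D C \<Gamma> = {(c, d). c \<in> Obj C \<and> d \<in> Obj D \<and> c \<in> M_set C (FOb \<Gamma> d)}"

definition cc_cone ::
  "('o, 'm) scat \<Rightarrow> ('p, 'n, 'o, 'm) cc \<Rightarrow> 'o \<times> 'p \<Rightarrow> ('o, 'm) cone" where
  "cc_cone C \<Gamma> = (\<lambda>(c, d). THE \<epsilon>.
     \<epsilon> \<in> idempotent_cones C \<and> vertex \<epsilon> = c \<and> H_functor C \<epsilon> = FOb \<Gamma> d)"

definition transpose_arrow ::
  "('p, 'n) scat \<Rightarrow> ('o, 'm) scat \<Rightarrow> ('p, 'n, 'o, 'm) cc \<Rightarrow>
     'o \<times> 'p \<Rightarrow> 'o \<times> 'p \<Rightarrow> 'm \<Rightarrow> 'n" where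
  "transpose_arrow D C \<Gamma> e e' f = (THE g. g \<in> Hom D (snd e) (snd e') \<and>
     (\<forall>x \<in> Obj C. \<forall>k \<in> Hom C (fst e) x.
        component (FAr \<Gamma> g) x (cone_act C (cc_cone C \<Gamma> e) k) =
        cone_act C (cc_cone C \<Gamma> e') (Cmp C f k)))"

definition dual_cone ::
  "('p, 'n) scat \<Rightarrow> ('o, 'm) scat \<Rightarrow> ('p, 'n, 'o, 'm) cc \<Rightarrow> 'o \<times> 'p \<Rightarrow> ('p, 'n) cone" where
  "dual_cone D C \<Gamma> e = (THE \<delta>. \<delta> \<in> normal_cones D \<and> vertex \<delta> = snd e \<and>
     (\<forall>e' \<in> cc_pairs D C \<Gamma>.
        leg \<delta> (snd e') = transpose_arrow D C \<Gamma> e' e (leg (cc_cone C \<Gamma> e') (fst e))))"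

definition is_dual ::
  "('p, 'n) scat \<Rightarrow> ('o, 'm) scat \<Rightarrow> ('p, 'n, 'o, 'm) cc \<Rightarrow> ('o, 'm, 'p, 'n) cc \<Rightarrow> bool" where
  "is_dual D C \<Gamma> \<Delta> \<longleftrightarrow>
     cross_connection C D \<Delta> \<and>
     (\<forall>e \<in> cc_pairs D C \<Gamma>. FOb \<Delta> (fst e) = H_functor D (dual_cone D C \<Gamma> e)) \<and>
     (\<forall>e \<in> cc_pairs D C \<Gamma>. \<forall>e' \<in> cc_pairs D C \<Gamma>. \<forall>f \<in> Hom C (fst e) (fst e').
        \<forall>y \<in> Obj D. \<forall>k \<in> Hom D (snd e) y.
          component (FAr \<Delta> f) y (cone_act D (dual_cone D C \<Gamma> e) k) =
          cone_act D (dual_cone D C \<Gamma> e') (Cmp D (transpose_arrow D C \<Gamma> e' e f) k))"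

definition is_duality ::
  "('p, 'n) scat \<Rightarrow> ('o, 'm) scat \<Rightarrow> ('p, 'n, 'o, 'm) cc \<Rightarrow> ('o, 'm, 'p, 'n) cc \<Rightarrow>
     ('o \<Rightarrow> 'p \<Rightarrow> ('o, 'm) cone \<Rightarrow> ('p, 'n) cone) \<Rightarrow> bool" where
  "is_duality D C \<Gamma> \<Delta> \<chi> \<longleftrightarrow>
     (\<forall>c \<in> Obj C. \<forall>d \<in> Obj D.
        bij_betw (\<chi> c d) (bifunctor_ob \<Gamma> c d) (bifunctor_ob \<Delta> d c)) \<and>
     (\<forall>f \<in> Arr C. \<forall>g \<in> Arr D. \<forall>x \<in> bifunctor_ob \<Gamma> (Dom C f) (Dom D g).
        \<chi> (Cod C f) (Cod D g) (bifunctor_ar D C \<Gamma> f g x) =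
        bifunctor_ar C D \<Delta> g f (\<chi> (Dom C f) (Dom D g) x)) \<and>
     (\<forall>(c', d) \<in> cc_pairs D C \<Gamma>. \<forall>(c, d') \<in> cc_pairs D C \<Gamma>. \<forall>f \<in> Hom C c' c.
        \<chi> c d (cone_act C (cc_cone C \<Gamma> (c', d)) f) =
        cone_act D (dual_cone D C \<Gamma> (c, d')) (transpose_arrow D C \<Gamma> (c, d') (c', d) f))"

text \<open>
  Note the order of the arguments: \<open>bifunctor_ob \<Delta> d c\<close> is \<open>\<Delta>(c, d) = \<Delta>(c)(d)\<close>, since
  \<open>\<Delta>\<close> starts at \<open>C\<close>; likewise \<open>bifunctor_ar C D \<Delta> g f\<close> is \<open>\<Delta>(f, g)\<close>.
\<close>

definition U_cones ::
  "('p, 'n) scat \<Rightarrow> ('o, 'm) scat \<Rightarrow> ('p, 'n, 'o, 'm) cc \<Rightarrow> ('o, 'm) cone set" where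
  "U_cones D C \<Gamma> = (\<Union>c \<in> Obj C. \<Union>d \<in> Obj D. bifunctor_ob \<Gamma> c d)"

definition linked ::
  "('p, 'n) scat \<Rightarrow> ('o, 'm) scat \<Rightarrow> ('p, 'n, 'o, 'm) cc \<Rightarrow>
     ('o \<Rightarrow> 'p \<Rightarrow> ('o, 'm) cone \<Rightarrow> ('p, 'n) cone) \<Rightarrow>
     ('o, 'm) cone \<Rightarrow> ('p, 'n) cone \<Rightarrow> bool" where
  "linked D C \<Gamma> \<chi> \<gamma> \<delta> \<longleftrightarrow>
     (\<exists>c \<in> Obj C. \<exists>d \<in> Obj D. \<gamma> \<in> bifunctor_ob \<Gamma> c d \<and> \<delta> = \<chi> c d \<gamma>)"

definition cc_semigroup ::
  "('p, 'n) scat \<Rightarrow> ('o, 'm) scat \<Rightarrow> ('p, 'n, 'o, 'm) cc \<Rightarrow> ('o, 'm, 'p, 'n) cc \<Rightarrow>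
     ('o \<Rightarrow> 'p \<Rightarrow> ('o, 'm) cone \<Rightarrow> ('p, 'n) cone) \<Rightarrow>
     (('o, 'm) cone \<times> ('p, 'n) cone) sgrp" where
  "cc_semigroup D C \<Gamma> \<Delta> \<chi> =
     \<lparr>carrier = {(\<gamma>, \<delta>). \<gamma> \<in> U_cones D C \<Gamma> \<and> \<delta> \<in> U_cones C D \<Delta> \<and> linked D C \<Gamma> \<chi> \<gamma> \<delta>},
      smult = (\<lambda>(\<gamma>, \<delta>) (\<gamma>', \<delta>'). (cone_mult C \<gamma> \<gamma>', cone_mult D \<delta>' \<delta>))\<rparr>"


section \<open>The categories of principal ideals of a Rees matrix semigroup\<close>

text \<open>
  Arrows are triples of a source, a map that is extensional on the source, and a target.
\<close>

type_synonym 'a maparr = "'a set \<times> ('a \<Rightarrow> 'a) \<times> 'a set"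

definition concrete_cat :: "'a set set \<Rightarrow> 'a maparr set \<Rightarrow> ('a set, 'a maparr) scat" where
  "concrete_cat \<A> \<M> =
     \<lparr>Obj = \<A>,
      Arr = \<M>,
      Dom = (\<lambda>(A, f, B). A),
      Cod = (\<lambda>(A, f, B). B),
      Idt = (\<lambda>A. (A, \<lambda>x\<in>A. x, A)),
      Cmp = (\<lambda>(A, f, B) (A', f', B'). (A, compose A f' f, B')),
      Inc = {(A, f, B). (A, f, B) \<in> \<M> \<and> A \<subseteq> B \<and> f = (\<lambda>x\<in>A. x)}\<rparr>"

definition left_ideal :: "'g monoid \<Rightarrow> 'i set \<Rightarrow> 'l \<Rightarrow> ('g \<times> 'i \<times> 'l) set" where
  "left_ideal G I l = carrier G \<times> I \<times> {l}"

definition rho :: "'g monoid \<Rightarrow> 'i set \<Rightarrow> 'l \<Rightarrow> 'g \<Rightarrow> 'l \<Rightarrow> ('g \<times> 'i \<times> 'l) maparr" where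
  "rho G I l1 g l2 =
     (left_ideal G I l1, \<lambda>(h, i, l)\<in>left_ideal G I l1. (h \<otimes>\<^bsub>G\<^esub> g, i, l2), left_ideal G I l2)"

definition left_ideal_cat ::
  "'g monoid \<Rightarrow> 'i set \<Rightarrow> 'l set \<Rightarrow> (('g \<times> 'i \<times> 'l) set, ('g \<times> 'i \<times> 'l) maparr) scat" where
  "left_ideal_cat G I \<Lambda> =
     concrete_cat (left_ideal G I ` \<Lambda>)
       {rho G I l1 g l2 | l1 g l2. l1 \<in> \<Lambda> \<and> g \<in> carrier G \<and> l2 \<in> \<Lambda>}"

definition right_ideal :: "'g monoid \<Rightarrow> 'l set \<Rightarrow> 'i \<Rightarrow> ('g \<times> 'i \<times> 'l) set" where
  "right_ideal G \<Lambda> i = carrier G \<times> {i} \<times> \<Lambda>"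

definition kappa :: "'g monoid \<Rightarrow> 'l set \<Rightarrow> 'i \<Rightarrow> 'g \<Rightarrow> 'i \<Rightarrow> ('g \<times> 'i \<times> 'l) maparr" where
  "kappa G \<Lambda> i1 g i2 =
     (right_ideal G \<Lambda> i1, \<lambda>(h, i, l)\<in>right_ideal G \<Lambda> i1. (g \<otimes>\<^bsub>G\<^esub> h, i2, l), right_ideal G \<Lambda> i2)"

definition right_ideal_cat ::
  "'g monoid \<Rightarrow> 'i set \<Rightarrow> 'l set \<Rightarrow> (('g \<times> 'i \<times> 'l) set, ('g \<times> 'i \<times> 'l) maparr) scat" where
  "right_ideal_cat G I \<Lambda> =
     concrete_cat (right_ideal G \<Lambda> ` I)
       {kappa G \<Lambda> i1 g i2 | i1 g i2. i1 \<in> I \<and> g \<in> carrier G \<and> i2 \<in> I}"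

end

theory Submission
  imports Defs
begin

text \<open>
  Both ideal categories are connected groupoids with trivialized hom-sets: \<open>\<L>(S)\<close> has object set
  \<open>\<Lambda>\<close> and group \<open>G\<close>, and \<open>\<R>(S)\<close> has object set \<open>I\<close> and the opposite group.  A normal cone in
  \<open>\<L>(S)\<close> is a vector in \<open>G\<^sup>\<Lambda>\<close> together with a vertex, its functor \<open>H\<close> remembers exactly the
  class of the vector modulo right multiplication by \<open>G\<close>, and the natural transformations between
  two such functors are left multiplications.  So \<open>\<Gamma>\<close> sends \<open>i\<close> to the functor of the \<open>i\<close>-th
  column of \<open>P\<close> and \<open>\<kappa>(g)\<close> to multiplication by \<open>g\<close>; dually, \<open>\<Delta>\<close> is built from the rows.  The
  cone in \<open>\<Gamma>(\<lambda>, i)\<close> with legs \<open>p\<^bsub>\<mu>i\<^esub> a\<close> is linked to the cone in \<open>\<Delta>(\<lambda>, i)\<close> with legs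
  \<open>a p\<^bsub>\<lambda>j\<^esub>\<close>; these are right and left multiplication by \<open>(a, i, \<lambda>)\<close> in \<open>S\<close>, hence linked pairs
  multiply like elements of \<open>S\<close>.
\<close>

section \<open>Criteria for local isomorphisms and for isomorphisms of semigroups\<close>

lemma local_isomorphism_if_identity_inclusions:
  assumes F: "is_functor C D F" and ip: "inclusion_preserving C D F"
    and ff: "fully_faithful C D F"
    and C: "\<And>c. c \<in> Obj C \<Longrightarrow> {b \<in> Obj C. \<exists>j\<in>Inc C. Dom C j = b \<and> Cod C j = c} = {c}"
    and D: "\<And>d. d \<in> Obj D \<Longrightarrow> {b \<in> Obj D. \<exists>j\<in>Inc D. Dom D j = b \<and> Cod D j = d} = {d}"
  shows "local_isomorphism C D F"
proof -
  have "is_cat_iso (subobjects_cat C c) (subobjects_cat D (FOb F c)) F" if c: "c \<in> Obj C" for c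
  proof -
    have Fc: "FOb F c \<in> Obj D"
      using F c by (auto simp: is_functor_def)
    \<comment> \<open>By \<open>C\<close> and \<open>D\<close> both categories of subobjects have a
      single object, so bijectivity on arrows is full faithfulness at the one hom-set from
      \<open>c\<close> to itself.\<close>
    have "bij_betw (FAr F) (Hom C c c) (Hom D (FOb F c) (FOb F c))"
      using ff c by (auto simp: fully_faithful_def)
    moreover have "Hom C c c = {f \<in> Arr C. Dom C f = c \<and> Cod C f = c}"
      "Hom D (FOb F c) (FOb F c) = {f \<in> Arr D. Dom D f = FOb F c \<and> Cod D f = FOb F c}"
      by (auto simp: Hom_def)
    ultimately show ?thesis
      using F c unfolding is_cat_iso_def subobjects_cat_def C[OF c] D[OF Fc]
      by (auto simp: is_functor_def full_subcat_def Hom_def)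
  qed
  then show ?thesis
    using F ip ff by (auto simp: local_isomorphism_def)
qed


text \<open>The explicit map goes from triples to linked pairs, whereas the isomorphism is wanted
  from linked pairs to triples. Closure of \<open>T\<close> lets the inverse map be evaluated at a
  product.\<close>

lemma sgrp_isomorphic_if_iso_from:
  assumes bij: "bij_betw \<psi> (carrier T) (carrier S)"
    and closed: "\<And>x y. \<lbrakk>x \<in> carrier T; y \<in> carrier T\<rbrakk> \<Longrightarrow> smult T x y \<in> carrier T"
    and hom: "\<And>x y. \<lbrakk>x \<in> carrier T; y \<in> carrier T\<rbrakk> \<Longrightarrow> \<psi> (smult T x y) = smult S (\<psi> x) (\<psi> y)"
  shows "sgrp_isomorphic S T"
proof -
  define \<phi> where "\<phi> = the_inv_into (carrier T) \<psi>"
  have \<phi>: "\<phi> (\<psi> x) = x" if "x \<in> carrier T" for x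
    using bij that by (simp add: \<phi>_def bij_betw_def the_inv_into_f_f)
  have "bij_betw \<phi> (carrier S) (carrier T)"
    using bij unfolding \<phi>_def by (rule bij_betw_the_inv_into)
  moreover have "\<phi> (smult S u v) = smult T (\<phi> u) (\<phi> v)"
    if uv: "u \<in> carrier S" "v \<in> carrier S" for u v
  proof -
    obtain x y where "x \<in> carrier T" "y \<in> carrier T" "u = \<psi> x" "v = \<psi> y"
      using bij uv unfolding bij_betw_def by (metis imageE)
    then show ?thesis
      by (simp add: \<phi> closed flip: hom)
  qed
  ultimately show ?thesis
    by (auto simp: sgrp_isomorphic_def)
qed


section \<open>Connected groupoids with a trivialization\<close>

text \<open>A common setting for both ideal categories, so that cones and the normal dual are
  treated once and instantiated twice. \<open>ar_inj\<close> is stated for fixed endpoints;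
  \<open>Dom_ar\<close>, \<open>Cod_ar\<close> and \<open>ob_inj\<close> separate arrows with
  different ones.\<close>

locale coordinatized_groupoid = group G
  for G :: "'g monoid" (structure) +
  fixes C :: "('o, 'm) scat" and X :: "'x set"
    and ob :: "'x \<Rightarrow> 'o" and ar :: "'x \<Rightarrow> 'g \<Rightarrow> 'x \<Rightarrow> 'm"
  assumes X_nonempty: "X \<noteq> {}"
    and ob_inj: "inj_on ob X"
    and Obj_eq: "Obj C = ob ` X"
    and Arr_eq: "Arr C = {ar x g y | x g y. x \<in> X \<and> g \<in> carrier G \<and> y \<in> X}"
    and ar_inj: "\<lbrakk>x \<in> X; y \<in> X; g \<in> carrier G; h \<in> carrier G; ar x g y = ar x h y\<rbrakk> \<Longrightarrow> g = h"
    and Dom_ar [simp]: "\<lbrakk>x \<in> X; y \<in> X; g \<in> carrier G\<rbrakk> \<Longrightarrow> Dom C (ar x g y) = ob x"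
    and Cod_ar [simp]: "\<lbrakk>x \<in> X; y \<in> X; g \<in> carrier G\<rbrakk> \<Longrightarrow> Cod C (ar x g y) = ob y"
    and Idt_ob [simp]: "x \<in> X \<Longrightarrow> Idt C (ob x) = ar x \<one> x"
    and Cmp_ar [simp]: "\<lbrakk>x \<in> X; y \<in> X; z \<in> X; g \<in> carrier G; h \<in> carrier G\<rbrakk> \<Longrightarrow>
        Cmp C (ar x g y) (ar y h z) = ar x (g \<otimes> h) z"
    and Inc_eq: "Inc C = (\<lambda>x. ar x \<one> x) ` X"
begin

definition ix :: "'o \<Rightarrow> 'x" where
  "ix = the_inv_into X ob"

definition coef :: "'m \<Rightarrow> 'g" where
  "coef f = (THE g. g \<in> carrier G \<and> f = ar (ix (Dom C f)) g (ix (Cod C f)))"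

lemma ix_ob [simp]: "x \<in> X \<Longrightarrow> ix (ob x) = x"
  unfolding ix_def by (rule the_inv_into_f_f[OF ob_inj])

lemma ob_in [simp]: "x \<in> X \<Longrightarrow> ob x \<in> Obj C"
  by (simp add: Obj_eq)

lemma ob_eq_iff [simp]: "\<lbrakk>x \<in> X; y \<in> X\<rbrakk> \<Longrightarrow> ob x = ob y \<longleftrightarrow> x = y"
  using ob_inj by (auto dest: inj_onD)

lemma ar_in [simp]: "\<lbrakk>x \<in> X; y \<in> X; g \<in> carrier G\<rbrakk> \<Longrightarrow> ar x g y \<in> Arr C"
  by (auto simp: Arr_eq)

lemma ar_eq_iff [simp]:
  "\<lbrakk>x \<in> X; y \<in> X; g \<in> carrier G; h \<in> carrier G\<rbrakk> \<Longrightarrow> ar x g y = ar x h y \<longleftrightarrow> g = h"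
  using ar_inj by blast

lemma ObjE:
  assumes "c \<in> Obj C"
  obtains x where "x \<in> X" "c = ob x"
  using assms by (auto simp: Obj_eq)

lemma ArrE:
  assumes "f \<in> Arr C"
  obtains x g y where "x \<in> X" "g \<in> carrier G" "y \<in> X" "f = ar x g y"
  using assms by (auto simp: Arr_eq)

lemma Hom_ob:
  assumes "x \<in> X" "y \<in> X"
  shows "Hom C (ob x) (ob y) = (\<lambda>g. ar x g y) ` carrier G"
  using assms by (force simp: Hom_def Arr_eq)

lemma coef_ar [simp]: "\<lbrakk>x \<in> X; y \<in> X; g \<in> carrier G\<rbrakk> \<Longrightarrow> coef (ar x g y) = g"
  unfolding coef_def by (rule the_equality) auto

lemma iso_arrow_ar: 
  assumes "x \<in> X" "y \<in> X" "g \<in> carrier G"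
  shows "iso_arrow C (ar x g y)"
  using assms unfolding iso_arrow_def
  by (auto simp: Hom_ob intro!: bexI[of _ "inv g"])

lemma subobjects:
  "c \<in> Obj C \<Longrightarrow> {b \<in> Obj C. \<exists>j\<in>Inc C. Dom C j = b \<and> Cod C j = c} = {c}"
  by (auto simp: Obj_eq Inc_eq)


subsection \<open>Normal cones and the normal dual in coordinates\<close>

text \<open>The parametrization is redundant on purpose: only the products of \<open>p m\<close>
  with \<open>a\<close> and the vertex matter. For fixed \<open>p\<close>, the coordinate
  \<open>a\<close> runs through the cones of one functor; \<open>vfun\<close> multiplies it from the
  right, \<open>vtrans\<close> from the left.\<close>

definition vcone :: "('x \<Rightarrow> 'g) \<Rightarrow> 'g \<Rightarrow> 'x \<Rightarrow> ('o, 'm) cone" where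
  "vcone p a x = \<lparr>vertex = ob x, leg = (\<lambda>c\<in>Obj C. ar (ix c) (p (ix c) \<otimes> a) x)\<rparr>"

definition vcones :: "('x \<Rightarrow> 'g) \<Rightarrow> 'x \<Rightarrow> ('o, 'm) cone set" where
  "vcones p x = (\<lambda>a. vcone p a x) ` carrier G"

definition vcoef :: "('x \<Rightarrow> 'g) \<Rightarrow> 'x \<Rightarrow> ('o, 'm) cone \<Rightarrow> 'g" where
  "vcoef p x \<sigma> = (THE a. a \<in> carrier G \<and> \<sigma> = vcone p a x)"

text \<open>
  Since \<open>(\<gamma> * f) * g = \<gamma> * (fg)\<close>, the functor \<open>H(\<gamma>; -)\<close> acts by \<open>\<sigma> \<mapsto> \<sigma> * g\<close>; so it depends
  only on the class of the vector \<open>p\<close> of coordinates of \<open>\<gamma>\<close> modulo right multiplication.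
\<close>

definition vfun :: "('x \<Rightarrow> 'g) \<Rightarrow> ('o, 'm, ('o, 'm) cone) setfunc" where
  "vfun p = \<lparr>FOb = (\<lambda>c\<in>Obj C. vcones p (ix c)),
             FAr = (\<lambda>f\<in>Arr C. \<lambda>\<sigma>\<in>vcones p (ix (Dom C f)). cone_act C \<sigma> f)\<rparr>"

definition vtrans :: "('x \<Rightarrow> 'g) \<Rightarrow> ('x \<Rightarrow> 'g) \<Rightarrow> 'g \<Rightarrow> 'o \<Rightarrow> ('o, 'm) cone \<Rightarrow> ('o, 'm) cone" where
  "vtrans p q g = (\<lambda>c\<in>Obj C. \<lambda>\<sigma>\<in>vcones p (ix c). vcone q (g \<otimes> vcoef p (ix c) \<sigma>) (ix c))"

lemma vertex_vcone [simp]: "vertex (vcone p a x) = ob x"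
  by (simp add: vcone_def)

lemma leg_vcone [simp]: "m \<in> X \<Longrightarrow> leg (vcone p a x) (ob m) = ar m (p m \<otimes> a) x"
  by (simp add: vcone_def)

lemma vcone_inject [simp]:
  assumes "p \<in> X \<rightarrow> carrier G" "a \<in> carrier G" "b \<in> carrier G" "x \<in> X"
  shows "vcone p a x = vcone p b x \<longleftrightarrow> a = b"
proof
  assume "vcone p a x = vcone p b x"
  \<comment> \<open>A single leg decides, because \<open>p x\<close> cancels.\<close>
  then have "leg (vcone p a x) (ob x) = leg (vcone p b x) (ob x)"
    by simp
  then show "a = b"
    using assms by (auto simp: Pi_iff)
qed simp

lemma vcone_in [simp]: "a \<in> carrier G \<Longrightarrow> vcone p a x \<in> vcones p x"
  by (simp add: vcones_def)

lemma vcoef_vcone [simp]: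
  assumes "p \<in> X \<rightarrow> carrier G" "a \<in> carrier G" "x \<in> X"
  shows "vcoef p x (vcone p a x) = a"
  unfolding vcoef_def using assms by (intro the_equality) auto

lemma vcone_normal:
  assumes "p \<in> X \<rightarrow> carrier G" "a \<in> carrier G" "x \<in> X"
  shows "vcone p a x \<in> normal_cones C"
  using assms by (auto simp: normal_cones_def vcone_def Obj_eq Hom_ob Pi_iff)

lemma normal_cone_eqI:
  assumes \<gamma>: "\<gamma> \<in> normal_cones C" and \<delta>: "\<delta> \<in> normal_cones C"
    and "vertex \<gamma> = vertex \<delta>" and "\<And>m. m \<in> X \<Longrightarrow> leg \<gamma> (ob m) = leg \<delta> (ob m)"
  shows "\<gamma> = \<delta>"
proof (rule cone.equality)
  have "leg \<gamma> \<in> extensional (Obj C)" "leg \<delta> \<in> extensional (Obj C)"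
    using \<gamma> \<delta> by (auto simp: normal_cones_def PiE_def)
  then show "leg \<gamma> = leg \<delta>"
    by (rule extensionalityI) (use assms(4) in \<open>auto simp: Obj_eq\<close>)
qed (use assms(3) in auto)

lemma normal_coneE:
  assumes "\<gamma> \<in> normal_cones C"
  obtains p x where "p \<in> X \<rightarrow> carrier G" "x \<in> X" "\<gamma> = vcone p \<one> x"
proof -
  obtain x where x: "x \<in> X" "vertex \<gamma> = ob x"
    using assms by (auto simp: normal_cones_def Obj_eq)
  have L: "leg \<gamma> \<in> (\<Pi>\<^sub>E c \<in> Obj C. Hom C c (ob x))"
    using assms x by (simp add: normal_cones_def)
  then have "\<exists>g. g \<in> carrier G \<and> leg \<gamma> (ob m) = ar m g x" if "m \<in> X" for m
    using PiE_mem[OF L, of "ob m"] that x by (auto simp: Hom_ob)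
  then obtain p where p: "\<And>m. m \<in> X \<Longrightarrow> p m \<in> carrier G \<and> leg \<gamma> (ob m) = ar m (p m) x"
    by metis
  then have "\<gamma> = vcone p \<one> x"
    using x assms by (intro normal_cone_eqI vcone_normal) (auto simp: Pi_iff)
  with p x that show ?thesis by blast
qed

lemma cone_act_vcone [simp]:
  assumes "p \<in> X \<rightarrow> carrier G" "a \<in> carrier G" "x \<in> X" "g \<in> carrier G" "y \<in> X"
  shows "cone_act C (vcone p a x) (ar x g y) = vcone p (a \<otimes> g) y"
  using assms by (auto simp: cone_act_def vcone_def Obj_eq Pi_iff m_assoc intro!: restrict_ext)

lemma cone_mult_vcone:
  assumes "p \<in> X \<rightarrow> carrier G" "a \<in> carrier G" "x \<in> X"
    "q \<in> X \<rightarrow> carrier G" "b \<in> carrier G" "y \<in> X"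
  shows "cone_mult C (vcone p a x) (vcone q b y) = vcone p (a \<otimes> q x \<otimes> b) y"
  using assms by (auto simp: cone_mult_def vcone_def Obj_eq Pi_iff m_assoc intro!: restrict_ext)

lemma vcone_idempotent_iff:
  assumes "p \<in> X \<rightarrow> carrier G" "a \<in> carrier G" "x \<in> X"
  shows "vcone p a x \<in> idempotent_cones C \<longleftrightarrow> a = inv (p x)"
proof -
  have px: "p x \<in> carrier G"
    using assms by auto
  have "vcone p a x \<in> idempotent_cones C \<longleftrightarrow> a \<otimes> p x \<otimes> a = a"
    using assms px vcone_normal[OF assms]
    by (simp add: idempotent_cones_def sgrp_idempotents_def cone_semigroup_def cone_mult_vcone)
  also have "\<dots> \<longleftrightarrow> a \<otimes> p x = \<one>"
    using assms(2) px by simp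
  also have "\<dots> \<longleftrightarrow> a = inv (p x)"
    using assms(2) px inv_equality by auto
  finally show ?thesis .
qed

lemma cone_act_image:
  assumes "p \<in> X \<rightarrow> carrier G" "a \<in> carrier G" "x \<in> X" "y \<in> X"
  shows "cone_act C (vcone p a x) ` Hom C (ob x) (ob y) = vcones p y"
proof
  show "cone_act C (vcone p a x) ` Hom C (ob x) (ob y) \<subseteq> vcones p y"
    using assms by (auto simp: Hom_ob)
  show "vcones p y \<subseteq> cone_act C (vcone p a x) ` Hom C (ob x) (ob y)"
  proof
    fix \<sigma> assume "\<sigma> \<in> vcones p y"
    then obtain b where b: "b \<in> carrier G" "\<sigma> = vcone p b y"
      by (auto simp: vcones_def)
    \<comment> \<open>The arrow is labelled by the solution g of a g = b. Right multiplication is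
      transitive, so the image is all of \<open>vcones p y\<close>, whatever \<open>a\<close> and
      \<open>x\<close> are.\<close>
    then have "\<sigma> = cone_act C (vcone p a x) (ar x (inv a \<otimes> b) y)"
      using assms by (simp add: m_assoc[symmetric])
    moreover have "ar x (inv a \<otimes> b) y \<in> Hom C (ob x) (ob y)"
      using assms b by (simp add: Hom_ob)
    ultimately show "\<sigma> \<in> cone_act C (vcone p a x) ` Hom C (ob x) (ob y)"
      by (rule image_eqI)
  qed
qed

lemma H_functor_vcone:
  assumes "p \<in> X \<rightarrow> carrier G" "a \<in> carrier G" "x \<in> X"
  shows "H_functor C (vcone p a x) = vfun p"
proof -
  have 1: "cone_act C (vcone p a x) ` Hom C (ob x) c = vcones p (ix c)" if "c \<in> Obj C" for c
    using that assms cone_act_image by (metis ObjE ix_ob)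
  have 2: "(THE \<tau>. \<exists>f\<in>Hom C (ob x) (Dom C g).
      \<sigma> = cone_act C (vcone p a x) f \<and> \<tau> = cone_act C (vcone p a x) (Cmp C f g)) = cone_act C \<sigma> g"
    if g: "g \<in> Arr C" and s: "\<sigma> \<in> vcones p (ix (Dom C g))" for g \<sigma>
  proof -
    obtain y h z where y: "y \<in> X" "h \<in> carrier G" "z \<in> X" "g = ar y h z"
      using g by (rule ArrE)
    \<comment> \<open>The value depends on \<open>f\<close> only through the cone it produces, so
      the description in \<open>H_functor\<close> is single valued.\<close>
    have *: "cone_act C (vcone p a x) (Cmp C f g) = cone_act C (cone_act C (vcone p a x) f) g"
      if "f \<in> Hom C (ob x) (ob y)" for f
      using that assms y by (auto simp: Hom_ob m_assoc)
    have "\<sigma> \<in> cone_act C (vcone p a x) ` Hom C (ob x) (ob y)"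
      using s y assms by (simp add: cone_act_image)
    then obtain f where f: "f \<in> Hom C (ob x) (ob y)" "\<sigma> = cone_act C (vcone p a x) f"
      by blast
    show ?thesis
    proof (rule the_equality)
      show "\<exists>f\<in>Hom C (ob x) (Dom C g). \<sigma> = cone_act C (vcone p a x) f \<and>
        cone_act C \<sigma> g = cone_act C (vcone p a x) (Cmp C f g)"
        using f y * by (intro bexI[of _ f]) auto
    qed (use y * in auto)
  qed
  have "Dom C g \<in> Obj C" if "g \<in> Arr C" for g
    using that by (auto elim!: ArrE)
  then show ?thesis
    unfolding H_functor_def vfun_def vertex_vcone by (simp add: 1 2 cong: restrict_cong)
qed

lemma FOb_vfun [simp]: "x \<in> X \<Longrightarrow> FOb (vfun p) (ob x) = vcones p x"
  by (simp add: vfun_def)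

lemma FAr_vfun [simp]:
  assumes "p \<in> X \<rightarrow> carrier G" "a \<in> carrier G" "x \<in> X" "g \<in> carrier G" "y \<in> X"
  shows "FAr (vfun p) (ar x g y) (vcone p a x) = vcone p (a \<otimes> g) y"
  using assms by (simp add: vfun_def)

lemma dual_objects:
  "H_functor C ` idempotent_cones C = vfun ` (X \<rightarrow> carrier G)"
proof
  show "H_functor C ` idempotent_cones C \<subseteq> vfun ` (X \<rightarrow> carrier G)"
  proof clarify
    fix \<gamma> assume "\<gamma> \<in> idempotent_cones C"
    then have "\<gamma> \<in> normal_cones C"
      by (simp add: idempotent_cones_def sgrp_idempotents_def cone_semigroup_def)
    then show "H_functor C \<gamma> \<in> vfun ` (X \<rightarrow> carrier G)"
      by (rule normal_coneE) (auto simp: H_functor_vcone)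
  qed
  obtain x where x: "x \<in> X"
    using X_nonempty by blast
  show "vfun ` (X \<rightarrow> carrier G) \<subseteq> H_functor C ` idempotent_cones C"
  proof clarify
    fix p assume p: "p \<in> X \<rightarrow> carrier G"
    then have "vcone p (inv (p x)) x \<in> idempotent_cones C"
      "H_functor C (vcone p (inv (p x)) x) = vfun p"
      using x by (auto simp: vcone_idempotent_iff H_functor_vcone Pi_iff)
    then show "vfun p \<in> H_functor C ` idempotent_cones C"
      by (metis imageI)
  qed
qed

text \<open>One common cone suffices: both functors are the \<open>H_functor\<close> of that
  cone.\<close>

lemma vfun_eq_if_subset:
  assumes p: "p \<in> X \<rightarrow> carrier G" and q: "q \<in> X \<rightarrow> carrier G" and x: "x \<in> X"
    and sub: "vcones p x \<subseteq> vcones q x"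
  shows "vfun p = vfun q"
proof -
  have "vcone p \<one> x \<in> vcones q x"
    using sub by auto
  then obtain t where t: "t \<in> carrier G" "vcone p \<one> x = vcone q t x"
    by (auto simp: vcones_def)
  have "vfun p = H_functor C (vcone p \<one> x)"
    using p x by (simp add: H_functor_vcone)
  also have "\<dots> = vfun q"
    using q x t(1) by (simp only: t(2) H_functor_vcone)
  finally show ?thesis .
qed

text \<open>All arrows are isomorphisms, and every class of vectors contains an idempotent cone at
  each vertex.\<close>

lemma M_set_vfun:
  assumes p: "p \<in> X \<rightarrow> carrier G"
  shows "M_set C (vfun p) = Obj C"
proof
  show "Obj C \<subseteq> M_set C (vfun p)"
  proof
    fix c assume "c \<in> Obj C"
    then obtain x where x: "x \<in> X" "c = ob x"
      by (rule ObjE)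
    show "c \<in> M_set C (vfun p)"
      unfolding M_set_def
      using x p by (auto intro!: bexI[of _ "vcone p (inv (p x)) x"] iso_arrow_ar
          simp: H_functor_vcone vcone_idempotent_iff Pi_iff)
  qed
qed (auto simp: M_set_def)

lemma idempotent_cone_unique:
  assumes p: "p \<in> X \<rightarrow> carrier G" and x: "x \<in> X"
  shows "(THE \<epsilon>. \<epsilon> \<in> idempotent_cones C \<and> vertex \<epsilon> = ob x \<and> H_functor C \<epsilon> = vfun p) =
    vcone p (inv (p x)) x"
proof (rule the_equality)
  show "vcone p (inv (p x)) x \<in> idempotent_cones C \<and> vertex (vcone p (inv (p x)) x) = ob x \<and>
    H_functor C (vcone p (inv (p x)) x) = vfun p"
    using assms by (auto simp: vcone_idempotent_iff H_functor_vcone Pi_iff)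
next
  fix \<epsilon> assume e: "\<epsilon> \<in> idempotent_cones C \<and> vertex \<epsilon> = ob x \<and> H_functor C \<epsilon> = vfun p"
  then have "\<epsilon> \<in> normal_cones C"
    by (simp add: idempotent_cones_def sgrp_idempotents_def cone_semigroup_def)
  then obtain q y where q: "q \<in> X \<rightarrow> carrier G" "y \<in> X" "\<epsilon> = vcone q \<one> y"
    by (rule normal_coneE)
  with e x have "y = x" "vfun q = vfun p"
    by (auto simp: H_functor_vcone)
  \<comment> \<open>Evaluating the functors at the vertex itself rewrites the cone with the vector
    \<open>p\<close>; idempotency then fixes its remaining coordinate.\<close>
  then have "FOb (vfun q) (ob x) = FOb (vfun p) (ob x)"
    by simp
  then have "\<epsilon> \<in> vcones p x"
    using q x \<open>y = x\<close> by auto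
  then obtain a where "a \<in> carrier G" "\<epsilon> = vcone p a x"
    by (auto simp: vcones_def)
  with e p x show "\<epsilon> = vcone p (inv (p x)) x"
    by (simp add: vcone_idempotent_iff)
qed

section \<open>Natural transformations between the functors of two vectors\<close>

lemma vtrans_vcone [simp]:
  assumes "p \<in> X \<rightarrow> carrier G" "a \<in> carrier G" "x \<in> X"
  shows "vtrans p q g (ob x) (vcone p a x) = vcone q (g \<otimes> a) x"
  using assms by (simp add: vtrans_def)

lemma nat_trans_vfun_ext:
  assumes \<eta>: "\<eta> \<in> (\<Pi>\<^sub>E c \<in> Obj C. (FOb (vfun p) c \<rightarrow>\<^sub>E A c))"
    and \<theta>: "\<theta> \<in> (\<Pi>\<^sub>E c \<in> Obj C. (FOb (vfun p) c \<rightarrow>\<^sub>E B c))"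
    and eq: "\<And>x a. \<lbrakk>x \<in> X; a \<in> carrier G\<rbrakk> \<Longrightarrow> \<eta> (ob x) (vcone p a x) = \<theta> (ob x) (vcone p a x)"
  shows "\<eta> = \<theta>"
proof (intro ext)
  fix c \<sigma>
  show "\<eta> c \<sigma> = \<theta> c \<sigma>"
  proof (cases "c \<in> Obj C \<and> \<sigma> \<in> FOb (vfun p) c")
    case True
    then show ?thesis
      using eq by (auto simp: Obj_eq vcones_def)
  next
    \<comment> \<open>Outside the domain, in the object or in the cone, both families are
      \<open>undefined\<close> by extensionality.\<close>
    case False
    then show ?thesis
      using PiE_arb[OF \<eta>, of c] PiE_arb[OF \<theta>, of c] PiE_mem[OF \<eta>, of c] PiE_mem[OF \<theta>, of c]
        PiE_arb[of "\<eta> c" "FOb (vfun p) c" _ \<sigma>] PiE_arb[of "\<theta> c" "FOb (vfun p) c" _ \<sigma>]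
      by (cases "c \<in> Obj C") auto
  qed
qed

lemma vtrans_PiE:
  assumes "p \<in> X \<rightarrow> carrier G" "q \<in> X \<rightarrow> carrier G" "g \<in> carrier G"
  shows "vtrans p q g \<in> (\<Pi>\<^sub>E c \<in> Obj C. (FOb (vfun p) c \<rightarrow>\<^sub>E FOb (vfun q) c))"
  using assms by (auto simp: vtrans_def Obj_eq vcones_def)

text \<open>Naturality is associativity: left multiplication commutes with the right multiplication
  by which arrows act.\<close>

lemma vtrans_nat_trans:
  assumes "p \<in> X \<rightarrow> carrier G" "q \<in> X \<rightarrow> carrier G" "g \<in> carrier G"
  shows "vtrans p q g \<in> nat_trans C (vfun p) (vfun q)"
  using assms vtrans_PiE[OF assms]
  by (auto simp: nat_trans_def vcones_def m_assoc elim!: ArrE)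

text \<open>A Yoneda argument: the image of the single cone \<open>vcone p \<one> x0\<close>
  determines the transformation.\<close>

lemma nat_transE:
  assumes eta: "\<eta> \<in> nat_trans C (vfun p) (vfun q)"
    and p: "p \<in> X \<rightarrow> carrier G" and q: "q \<in> X \<rightarrow> carrier G"
  obtains g where "g \<in> carrier G" "\<eta> = vtrans p q g"
proof -
  obtain x0 where x0: "x0 \<in> X"
    using X_nonempty by blast
  have E: "\<eta> \<in> (\<Pi>\<^sub>E c \<in> Obj C. (FOb (vfun p) c \<rightarrow>\<^sub>E FOb (vfun q) c))"
    using eta by (simp add: nat_trans_def)
  have "\<eta> (ob x0) (vcone p \<one> x0) \<in> vcones q x0"
    using PiE_mem[OF PiE_mem[OF E], of "ob x0" "vcone p \<one> x0"] x0 by simp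
  then obtain g where g: "g \<in> carrier G" "\<eta> (ob x0) (vcone p \<one> x0) = vcone q g x0"
    by (auto simp: vcones_def)
  have "\<eta> = vtrans p q g"
  proof (rule nat_trans_vfun_ext[OF E vtrans_PiE[OF p q g(1)]])
    fix x a assume x: "x \<in> X" "a \<in> carrier G"
    \<comment> \<open>The arrow from \<open>x0\<close> to \<open>x\<close> with label
      \<open>a\<close> carries the chosen cone to \<open>vcone p a x\<close>, so naturality along it
      gives the value there.\<close>
    have "FAr (vfun q) (ar x0 a x) (\<eta> (ob x0) (vcone p \<one> x0)) =
      \<eta> (ob x) (FAr (vfun p) (ar x0 a x) (vcone p \<one> x0))"
      using eta x x0 unfolding nat_trans_def
      by (auto dest!: bspec[where x = "ar x0 a x"] bspec[where x = "vcone p \<one> x0"])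
    then show "\<eta> (ob x) (vcone p a x) = vtrans p q g (ob x) (vcone p a x)"
      using x x0 p q g by simp
  qed
  with g that show ?thesis by blast
qed

lemma vtrans_inj:
  assumes "p \<in> X \<rightarrow> carrier G" "q \<in> X \<rightarrow> carrier G" "g \<in> carrier G" "h \<in> carrier G"
    and "vtrans p q g = vtrans p q h"
  shows "g = h"
proof -
  obtain x where x: "x \<in> X"
    using X_nonempty by blast
  have "vtrans p q g (ob x) (vcone p \<one> x) = vtrans p q h (ob x) (vcone p \<one> x)"
    by (simp only: assms(5))
  then show ?thesis
    using assms(1-4) x by simp
qed

lemma vtrans_one:
  assumes "p \<in> X \<rightarrow> carrier G"
  shows "vtrans p p \<one> = (\<lambda>c\<in>Obj C. \<lambda>\<sigma>\<in>FOb (vfun p) c. \<sigma>)"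
proof (rule nat_trans_vfun_ext)
  show "vtrans p p \<one> \<in> (\<Pi>\<^sub>E c \<in> Obj C. (FOb (vfun p) c \<rightarrow>\<^sub>E FOb (vfun p) c))"
    using assms by (intro vtrans_PiE) auto
  show "(\<lambda>c\<in>Obj C. \<lambda>\<sigma>\<in>FOb (vfun p) c. \<sigma>) \<in> (\<Pi>\<^sub>E c \<in> Obj C. (FOb (vfun p) c \<rightarrow>\<^sub>E FOb (vfun p) c))"
    by auto
qed (use assms in auto)

text \<open>First \<open>g\<close>, then \<open>h\<close> is left multiplication by
  \<open>h \<otimes> g\<close>. This reversal is why the category mapped into the normal dual must
  carry the opposite group.\<close>

lemma vtrans_comp:
  assumes "p \<in> X \<rightarrow> carrier G" "q \<in> X \<rightarrow> carrier G" "r \<in> X \<rightarrow> carrier G"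
    "g \<in> carrier G" "h \<in> carrier G"
  shows "(\<lambda>c\<in>Obj C. compose (FOb (vfun p) c) (vtrans q r h c) (vtrans p q g c)) =
    vtrans p r (h \<otimes> g)"
proof (rule nat_trans_vfun_ext)
  show "vtrans p r (h \<otimes> g) \<in> (\<Pi>\<^sub>E c \<in> Obj C. (FOb (vfun p) c \<rightarrow>\<^sub>E FOb (vfun r) c))"
    using assms by (intro vtrans_PiE) auto
  show "(\<lambda>c\<in>Obj C. compose (FOb (vfun p) c) (vtrans q r h c) (vtrans p q g c))
    \<in> (\<Pi>\<^sub>E c \<in> Obj C. (FOb (vfun p) c \<rightarrow>\<^sub>E FOb (vfun r) c))"
    using assms by (auto simp: Obj_eq vcones_def compose_def)
qed (use assms in \<open>auto simp: compose_def m_assoc\<close>)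

section \<open>The normal dual as a category\<close>

lemma Obj_dual: "Obj (normal_dual C) = vfun ` (X \<rightarrow> carrier G)"
  by (simp add: normal_dual_def functor_cat_def dual_objects)

lemma vtrans_Hom_dual:
  assumes "p \<in> X \<rightarrow> carrier G" "q \<in> X \<rightarrow> carrier G"
  shows "Hom (normal_dual C) (vfun p) (vfun q) =
    (\<lambda>g. (vfun p, vtrans p q g, vfun q)) ` carrier G"
proof -
  have "Hom (normal_dual C) (vfun p) (vfun q) =
    {(vfun p, \<eta>, vfun q) | \<eta>. \<eta> \<in> nat_trans C (vfun p) (vfun q)}"
    using assms by (auto simp: Hom_def normal_dual_def functor_cat_def dual_objects)
  moreover have "nat_trans C (vfun p) (vfun q) = vtrans p q ` carrier G"
    using assms by (auto simp: vtrans_nat_trans elim: nat_transE)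
  ultimately show ?thesis by auto
qed

lemma Idt_dual:
  assumes "p \<in> X \<rightarrow> carrier G"
  shows "Idt (normal_dual C) (vfun p) = (vfun p, vtrans p p \<one>, vfun p)"
  using assms by (simp add: normal_dual_def functor_cat_def vtrans_one)

lemma Idt_dual_Inc:
  assumes "p \<in> X \<rightarrow> carrier G"
  shows "(vfun p, vtrans p p \<one>, vfun p) \<in> Inc (normal_dual C)"
  using assms vtrans_nat_trans[OF assms assms one_closed]
  by (auto simp: normal_dual_def functor_cat_def dual_objects vtrans_one)

lemma Cmp_dual:
  assumes "p \<in> X \<rightarrow> carrier G" "q \<in> X \<rightarrow> carrier G" "r \<in> X \<rightarrow> carrier G"
    "g \<in> carrier G" "h \<in> carrier G"
  shows "Cmp (normal_dual C) (vfun p, vtrans p q g, vfun q) (vfun q, vtrans q r h, vfun r) =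
    (vfun p, vtrans p r (h \<otimes> g), vfun r)"
  using assms by (simp add: normal_dual_def functor_cat_def vtrans_comp)

text \<open>A subfunctor in the normal dual is the whole functor, by
  \<open>vfun_eq_if_subset\<close>; hence an object has no subobject but itself.\<close>

lemma Inc_dual_eq:
  assumes j: "j \<in> Inc (normal_dual C)"
  shows "Dom (normal_dual C) j = Cod (normal_dual C) j"
proof -
  obtain x where x: "x \<in> X"
    using X_nonempty by blast
  obtain F \<eta> K where FK: "j = (F, \<eta>, K)"
    by (cases j)
  with j have "F \<in> vfun ` (X \<rightarrow> carrier G)" "K \<in> vfun ` (X \<rightarrow> carrier G)"
    and sub: "FOb F (ob x) \<subseteq> FOb K (ob x)"
    using x by (simp_all add: normal_dual_def functor_cat_def dual_objects)
  then obtain p q where p: "p \<in> X \<rightarrow> carrier G" "F = vfun p"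
    and q: "q \<in> X \<rightarrow> carrier G" "K = vfun q"
    by blast
  then have "F = K"
    using vfun_eq_if_subset[OF p(1) q(1) x] sub x by simp
  then show ?thesis
    by (simp add: FK normal_dual_def functor_cat_def)
qed

lemma subobjects_dual:
  assumes F: "F \<in> Obj (normal_dual C)"
  shows "{K \<in> Obj (normal_dual C). \<exists>j\<in>Inc (normal_dual C).
    Dom (normal_dual C) j = K \<and> Cod (normal_dual C) j = F} = {F}"
proof -
  obtain p where p: "p \<in> X \<rightarrow> carrier G" "F = vfun p"
    using F by (auto simp: Obj_dual)
  have "\<exists>j\<in>Inc (normal_dual C). Dom (normal_dual C) j = F \<and> Cod (normal_dual C) j = F"
    by (rule bexI[of _ "(F, vtrans p p \<one>, F)"])
      (use p Idt_dual_Inc in \<open>auto simp: normal_dual_def functor_cat_def\<close>)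
  then show ?thesis
    using F Inc_dual_eq by blast
qed

end


section \<open>The cross-connection of a matrix\<close>

text \<open>
  \<open>H\<close> is the opposite of \<open>G\<close>.  Keeping both groups as parameters makes the situation symmetric:
  exchanging the two categories and transposing \<open>P\<close> turns \<open>\<Gamma>\<close> into its dual.
\<close>

locale matrix_connection =
  C: coordinatized_groupoid G C X ob ar + D: coordinatized_groupoid H D Y od dr
  for G :: "'g monoid" (structure) and C :: "('o, 'm) scat" and X :: "'x set"
    and ob :: "'x \<Rightarrow> 'o" and ar :: "'x \<Rightarrow> 'g \<Rightarrow> 'x \<Rightarrow> 'm"
    and H :: "'g monoid" and D :: "('p, 'n) scat" and Y :: "'y set"
    and od :: "'y \<Rightarrow> 'p" and dr :: "'y \<Rightarrow> 'g \<Rightarrow> 'y \<Rightarrow> 'n" +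
  fixes P :: "'x \<Rightarrow> 'y \<Rightarrow> 'g"
  assumes carrier_H: "carrier H = carrier G"
    and mult_H: "a \<otimes>\<^bsub>H\<^esub> b = b \<otimes> a"
    and one_H: "\<one>\<^bsub>H\<^esub> = \<one>"
    and P_closed [simp]: "\<lbrakk>x \<in> X; y \<in> Y\<rbrakk> \<Longrightarrow> P x y \<in> carrier G"
begin

lemmas opposite_simps = carrier_H mult_H one_H

definition col :: "'y \<Rightarrow> 'x \<Rightarrow> 'g" where
  "col y = (\<lambda>x. P x y)"

definition conn :: "('p, 'n, 'o, 'm) cc" where
  "conn = \<lparr>FOb = (\<lambda>d. C.vfun (col (D.ix d))),
           FAr = (\<lambda>f. (C.vfun (col (D.ix (Dom D f))),
                       C.vtrans (col (D.ix (Dom D f))) (col (D.ix (Cod D f))) (D.coef f),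
                       C.vfun (col (D.ix (Cod D f)))))\<rparr>"

lemma col_closed [simp]: "y \<in> Y \<Longrightarrow> col y \<in> X \<rightarrow> carrier G"
  by (simp add: col_def)

lemma FOb_conn [simp]: "y \<in> Y \<Longrightarrow> FOb conn (od y) = C.vfun (col y)"
  by (simp add: conn_def)

lemma FAr_conn [simp]:
  "\<lbrakk>y \<in> Y; z \<in> Y; g \<in> carrier G\<rbrakk> \<Longrightarrow>
     FAr conn (dr y g z) = (C.vfun (col y), C.vtrans (col y) (col z) g, C.vfun (col z))"
  by (simp add: conn_def opposite_simps)

text \<open>An arrow keeps its label, and the product in \<open>H\<close> absorbs the reversal of
  \<open>Cmp_dual\<close>.\<close>

lemma conn_functor: "is_functor D (normal_dual C) conn"
  by (auto simp: is_functor_def D.Obj_eq D.Arr_eq C.Obj_dual C.vtrans_Hom_dual C.Idt_dual C.Cmp_dual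
      opposite_simps)

lemma conn_fully_faithful: "fully_faithful D (normal_dual C) conn"
proof -
  have "bij_betw (FAr conn) (Hom D (od y) (od z)) (Hom (normal_dual C) (C.vfun (col y)) (C.vfun (col z)))"
    if "y \<in> Y" "z \<in> Y" for y z
    using that
    by (auto simp: bij_betw_def inj_on_def D.Hom_ob C.vtrans_Hom_dual image_image opposite_simps
        dest: C.vtrans_inj[OF col_closed col_closed, rotated -1])
  then show ?thesis
    by (auto simp: fully_faithful_def D.Obj_eq)
qed

lemma cross_connection_conn: "cross_connection D C conn"
proof -
  have "inclusion_preserving D (normal_dual C) conn"
    by (auto simp: inclusion_preserving_def D.Inc_eq C.Idt_dual_Inc opposite_simps)
  then have "local_isomorphism D (normal_dual C) conn"
    by (intro local_isomorphism_if_identity_inclusions conn_functor conn_fully_faithful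
        D.subobjects C.subobjects_dual)
  moreover have "\<exists>d\<in>Obj D. c \<in> M_set C (FOb conn d)" if "c \<in> Obj C" for c
    using that D.X_nonempty by (force simp: D.Obj_eq C.M_set_vfun)
  ultimately show ?thesis
    by (auto simp: cross_connection_def)
qed

lemma cc_pairs_conn: "cc_pairs D C conn = (\<lambda>(x, y). (ob x, od y)) ` (X \<times> Y)"
  by (auto simp: cc_pairs_def D.Obj_eq C.Obj_eq C.M_set_vfun)

lemma cc_cone_conn [simp]:
  "\<lbrakk>x \<in> X; y \<in> Y\<rbrakk> \<Longrightarrow> cc_cone C conn (ob x, od y) = C.vcone (col y) (inv (P x y)) x"
  using C.idempotent_cone_unique[OF col_closed, of y x] by (simp add: cc_cone_def col_def)

text \<open>For an arrow with label h, the defining condition compares the coordinates h p(x,y)^-1 k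
  and p(x',y')^-1 g k; cancelling k leaves one solution.\<close>

lemma transpose_conn [simp]:
  assumes [simp]: "x \<in> X" "y \<in> Y" "x' \<in> X" "y' \<in> Y" "g \<in> carrier G"
  shows "transpose_arrow D C conn (ob x, od y) (ob x', od y') (ar x' g x) =
    dr y (inv (P x' y') \<otimes> g \<otimes> P x y) y'"
proof -
  have *: "h \<otimes> (inv (P x y) \<otimes> k) = inv (P x' y') \<otimes> (g \<otimes> k) \<longleftrightarrow>
      h = inv (P x' y') \<otimes> g \<otimes> P x y"
    if [simp]: "h \<in> carrier G" "k \<in> carrier G" for h k
  proof -
    have "h \<otimes> (inv (P x y) \<otimes> k) = inv (P x' y') \<otimes> (g \<otimes> k) \<longleftrightarrow>
       h \<otimes> inv (P x y) \<otimes> k = inv (P x' y') \<otimes> g \<otimes> k"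
      by (simp add: C.m_assoc)
    also have "\<dots> \<longleftrightarrow> h \<otimes> inv (P x y) = inv (P x' y') \<otimes> g"
      by simp
    also have "\<dots> \<longleftrightarrow> h = inv (P x' y') \<otimes> g \<otimes> P x y"
      by (metis C.inv_closed C.inv_solve_right C.m_closed P_closed assms that(1))
    finally show ?thesis .
  qed
  show ?thesis
    unfolding transpose_arrow_def fst_conv snd_conv
  proof (rule the_equality)
    show "dr y (inv (P x' y') \<otimes> g \<otimes> P x y) y' \<in> Hom D (od y) (od y') \<and>
      (\<forall>c\<in>Obj C. \<forall>k\<in>Hom C (ob x) c.
        component (FAr conn (dr y (inv (P x' y') \<otimes> g \<otimes> P x y) y')) c
          (cone_act C (cc_cone C conn (ob x, od y)) k) =
        cone_act C (cc_cone C conn (ob x', od y')) (Cmp C (ar x' g x) k))"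
      by (auto simp: D.Hom_ob C.Obj_eq C.Hom_ob component_def opposite_simps *)
  next
    fix f
    assume f: "f \<in> Hom D (od y) (od y') \<and>
      (\<forall>c\<in>Obj C. \<forall>k\<in>Hom C (ob x) c.
        component (FAr conn f) c (cone_act C (cc_cone C conn (ob x, od y)) k) =
        cone_act C (cc_cone C conn (ob x', od y')) (Cmp C (ar x' g x) k))"
    then obtain h where h: "h \<in> carrier G" "f = dr y h y'"
      by (auto simp: D.Hom_ob opposite_simps)
    \<comment> \<open>For uniqueness it is enough to test the identity of \<open>ob x\<close>, the
      arrow with k = 1.\<close>
    have "ob x \<in> Obj C" "ar x \<one> x \<in> Hom C (ob x) (ob x)"
      by (auto simp: C.Hom_ob)
    with f have "component (FAr conn f) (ob x) (cone_act C (cc_cone C conn (ob x, od y)) (ar x \<one> x)) =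
        cone_act C (cc_cone C conn (ob x', od y')) (Cmp C (ar x' g x) (ar x \<one> x))"
      by blast
    then have "h \<otimes> (inv (P x y) \<otimes> \<one>) = inv (P x' y') \<otimes> (g \<otimes> \<one>)"
      using h by (simp add: component_def)
    then have "h = inv (P x' y') \<otimes> g \<otimes> P x y"
      using h(1) by (subst (asm) *) auto
    then show "f = dr y (inv (P x' y') \<otimes> g \<otimes> P x y) y'"
      by (simp add: h(2))
  qed
qed

section \<open>The dual cross-connection and the duality\<close>

lemma bifunctor_ob_conn:
  "\<lbrakk>x \<in> X; y \<in> Y\<rbrakk> \<Longrightarrow> bifunctor_ob conn (ob x) (od y) = (\<lambda>a. C.vcone (col y) a x) ` carrier G"
  by (simp add: bifunctor_ob_def C.vcones_def)

text \<open>Roles of the categories are exchanged and the matrix is transposed, so each fact about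
  \<open>conn\<close> yields one about \<open>dconn\<close>; \<open>opposite_simps\<close>
  translates its products back into \<open>G\<close>.\<close>

interpretation dual: matrix_connection H D Y od dr G C X ob ar "\<lambda>y x. P x y"
  by unfold_locales (auto simp: opposite_simps)

abbreviation row where "row \<equiv> dual.col"
abbreviation dconn where "dconn \<equiv> dual.conn"

lemma row_closed [simp]: "x \<in> X \<Longrightarrow> row x \<in> Y \<rightarrow> carrier G"
  by (simp add: dual.col_def)

text \<open>The leg of the idempotent cone of (x',y') at x has label p(x,y') p(x',y')^-1. Its
  transpose has label p(x,y)^-1 p(x,y'), from which x' has cancelled: the choice of x' does not
  matter and row x appears.\<close>

lemma dual_cone_conn [simp]:
  assumes [simp]: "x \<in> X" "y \<in> Y"
  shows "dual_cone D C conn (ob x, od y) = D.vcone (row x) (inv (P x y)) y" (is "_ = ?\<delta>")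
proof -
  have n: "?\<delta> \<in> normal_cones D"
    by (rule D.vcone_normal) (auto simp: opposite_simps)
  have leg: "leg ?\<delta> (od y') =
      transpose_arrow D C conn (ob x', od y') (ob x, od y) (leg (cc_cone C conn (ob x', od y')) (ob x))"
    if [simp]: "x' \<in> X" "y' \<in> Y" for x' y'
    by (simp add: opposite_simps dual.col_def col_def C.m_assoc)
  show ?thesis
    unfolding dual_cone_def
  proof (rule the_equality)
    show "?\<delta> \<in> normal_cones D \<and> vertex ?\<delta> = snd (ob x, od y) \<and>
      (\<forall>e'\<in>cc_pairs D C conn. leg ?\<delta> (snd e') =
        transpose_arrow D C conn e' (ob x, od y) (leg (cc_cone C conn e') (fst (ob x, od y))))"
      using n leg by (auto simp: cc_pairs_conn)
  next
    fix \<delta>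
    assume \<delta>: "\<delta> \<in> normal_cones D \<and> vertex \<delta> = snd (ob x, od y) \<and>
      (\<forall>e'\<in>cc_pairs D C conn. leg \<delta> (snd e') =
        transpose_arrow D C conn e' (ob x, od y) (leg (cc_cone C conn e') (fst (ob x, od y))))"
    have "leg \<delta> (od y') = leg ?\<delta> (od y')" if "y' \<in> Y" for y'
    proof -
      \<comment> \<open>The pair with x' = x already determines the leg at y'.\<close>
      have "(ob x, od y') \<in> cc_pairs D C conn"
        using that by (auto simp: cc_pairs_conn)
      with \<delta> that show ?thesis
        by (auto simp only: leg[OF \<open>x \<in> X\<close> that] fst_conv snd_conv)
    qed
    then show "\<delta> = ?\<delta>"
      using \<delta> n by (intro D.normal_cone_eqI) auto
  qed
qed

text \<open>In the last condition both sides have coordinate h p(x,y)^-1 g: the entry p(x',y')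
  brought in by the transpose cancels against the dual cone.\<close>

lemma is_dual_conn: "is_dual D C conn dconn"
  unfolding is_dual_def
proof (intro conjI ballI)
  show "cross_connection C D dconn"
    by (rule dual.cross_connection_conn)
next
  fix e assume "e \<in> cc_pairs D C conn"
  then obtain x y where "x \<in> X" "y \<in> Y" "e = (ob x, od y)"
    by (auto simp: cc_pairs_conn)
  then show "FOb dconn (fst e) = H_functor D (dual_cone D C conn e)"
    by (simp add: D.H_functor_vcone opposite_simps)
next
  fix e e' f c k
  assume "e \<in> cc_pairs D C conn" "e' \<in> cc_pairs D C conn"
    "f \<in> Hom C (fst e) (fst e')" "c \<in> Obj D" "k \<in> Hom D (snd e) c"
  then obtain x y x' y' z g h where
    [simp]: "x \<in> X" "y \<in> Y" "x' \<in> X" "y' \<in> Y" "z \<in> Y" "g \<in> carrier G" "h \<in> carrier G"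
    and "e = (ob x, od y)" "e' = (ob x', od y')" "c = od z" "f = ar x g x'" "k = dr y h z"
    by (auto simp: cc_pairs_conn C.Hom_ob D.Hom_ob D.Obj_eq opposite_simps)
  then show "component (FAr dconn f) c (cone_act D (dual_cone D C conn e) k) =
    cone_act D (dual_cone D C conn e') (Cmp D (transpose_arrow D C conn e' e f) k)"
    by (simp add: component_def opposite_simps C.m_assoc)
qed

text \<open>The coordinate is kept and the column replaced by the row. The formula for the duality
  on idempotent cones forces this, since its two sides have equal coordinates.\<close>

definition chi :: "'o \<Rightarrow> 'p \<Rightarrow> ('o, 'm) cone \<Rightarrow> ('p, 'n) cone" where
  "chi c d \<gamma> = D.vcone (row (C.ix c)) (C.vcoef (col (D.ix d)) (C.ix c) \<gamma>) (D.ix d)"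

lemma chi_vcone [simp]:
  "\<lbrakk>x \<in> X; y \<in> Y; a \<in> carrier G\<rbrakk> \<Longrightarrow>
     chi (ob x) (od y) (C.vcone (col y) a x) = D.vcone (row x) a y"
  by (simp add: chi_def)

lemma bifunctor_ob_dconn:
  "\<lbrakk>x \<in> X; y \<in> Y\<rbrakk> \<Longrightarrow> bifunctor_ob dconn (od y) (ob x) = (\<lambda>a. D.vcone (row x) a y) ` carrier G"
  using dual.bifunctor_ob_conn[of y x] by (simp add: opposite_simps)

text \<open>Arrows of \<open>C\<close> multiply the coordinate from the right and those of
  \<open>D\<close> from the left, so naturality is associativity in \<open>G\<close>.\<close>

lemma is_duality_chi: "is_duality D C conn dconn chi"
  unfolding is_duality_def
proof (intro conjI ballI)
  fix c d assume "c \<in> Obj C" "d \<in> Obj D"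
  then obtain x y where xy: "x \<in> X" "y \<in> Y" "c = ob x" "d = od y"
    by (auto simp: C.Obj_eq D.Obj_eq)
  then show "bij_betw (chi c d) (bifunctor_ob conn c d) (bifunctor_ob dconn d c)"
    by (auto simp: bij_betw_def inj_on_def image_image bifunctor_ob_conn bifunctor_ob_dconn
        opposite_simps)
next
  fix f g \<gamma>
  assume "f \<in> Arr C" "g \<in> Arr D" "\<gamma> \<in> bifunctor_ob conn (Dom C f) (Dom D g)"
  then obtain x x' y y' b h a where
    [simp]: "x \<in> X" "x' \<in> X" "y \<in> Y" "y' \<in> Y" "b \<in> carrier G" "h \<in> carrier G" "a \<in> carrier G"
    and "f = ar x b x'" "g = dr y h y'" "\<gamma> = C.vcone (col y) a x"
    by (auto simp: C.Arr_eq D.Arr_eq bifunctor_ob_conn opposite_simps)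
  then show "chi (Cod C f) (Cod D g) (bifunctor_ar D C conn f g \<gamma>) =
    bifunctor_ar C D dconn g f (chi (Dom C f) (Dom D g) \<gamma>)"
    by (simp add: bifunctor_ar_def component_def opposite_simps C.m_assoc)
next
  fix e
  assume "e \<in> cc_pairs D C conn"
  then show "case e of (c', d) \<Rightarrow> \<forall>(c, d')\<in>cc_pairs D C conn. \<forall>f\<in>Hom C c' c.
    chi c d (cone_act C (cc_cone C conn (c', d)) f) =
    cone_act D (dual_cone D C conn (c, d')) (transpose_arrow D C conn (c, d') (c', d) f)"
    by (auto simp: cc_pairs_conn C.Hom_ob opposite_simps C.m_assoc)
qed

section \<open>The cross-connection semigroup\<close>

lemma cc_semigroup_conn_carrier:
  "carrier (cc_semigroup D C conn dconn chi) =
    {(C.vcone (col y) a x, D.vcone (row x) a y) | a x y. a \<in> carrier G \<and> x \<in> X \<and> y \<in> Y}"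
proof -
  have "carrier (cc_semigroup D C conn dconn chi) =
    {(\<gamma>, chi c d \<gamma>) | \<gamma> c d. c \<in> Obj C \<and> d \<in> Obj D \<and> \<gamma> \<in> bifunctor_ob conn c d}"
    \<comment> \<open>The bijections of the duality put the second cone into the union for
      \<open>dconn\<close> automatically.\<close>
    using is_duality_chi
    by (fastforce simp: cc_semigroup_def U_cones_def linked_def is_duality_def bij_betw_def)
  also have "\<dots> = {(C.vcone (col y) a x, D.vcone (row x) a y) | a x y.
      a \<in> carrier G \<and> x \<in> X \<and> y \<in> Y}"
    by (force simp: C.Obj_eq D.Obj_eq bifunctor_ob_conn)
  finally show ?thesis .
qed

lemma cc_semigroup_conn_iso_rees:
  "sgrp_isomorphic (cc_semigroup D C conn dconn chi) (rees_matrix G Y X P)"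
proof (rule sgrp_isomorphic_if_iso_from)
  let ?\<psi> = "\<lambda>(a, y, x). (C.vcone (col y) a x, D.vcone (row x) a y)"
  show "bij_betw ?\<psi> (carrier (rees_matrix G Y X P)) (carrier (cc_semigroup D C conn dconn chi))"
    unfolding bij_betw_def
  proof
    show "inj_on ?\<psi> (carrier (rees_matrix G Y X P))"
    proof (rule inj_onI, clarsimp simp: rees_matrix_def)
      fix a y x b z w
      assume *: "a \<in> carrier G" "y \<in> Y" "x \<in> X" "b \<in> carrier G" "z \<in> Y" "w \<in> X"
        and c: "C.vcone (col y) a x = C.vcone (col z) b w"
        and d: "D.vcone (row x) a y = D.vcone (row w) b z"
      \<comment> \<open>Both cones are needed: proportional columns define the same functor, so the
        first cone may fail to determine \<open>y\<close>, which is the vertex of the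
        second.\<close>
      have "x = w" "y = z"
        using arg_cong[OF c, where f = vertex] arg_cong[OF d, where f = vertex] * by auto
      with * c show "a = b \<and> y = z \<and> x = w"
        by simp
    qed
    show "?\<psi> ` carrier (rees_matrix G Y X P) = carrier (cc_semigroup D C conn dconn chi)"
      by (force simp: cc_semigroup_conn_carrier rees_matrix_def)
  qed
\<comment> \<open>In \<open>D\<close> the factors are reversed and multiplied in the opposite group.
  The two reversals cancel, and both components receive the coordinate of the Rees product.\<close>
qed (auto simp: rees_matrix_def cc_semigroup_def C.cone_mult_vcone D.cone_mult_vcone
    opposite_simps col_def dual.col_def C.m_assoc)

lemma ex_cross_connection_rees:
  "\<exists>\<Gamma>. cross_connection D C \<Gamma> \<and>
    (\<exists>\<Delta> \<chi>. is_dual D C \<Gamma> \<Delta> \<and> is_duality D C \<Gamma> \<Delta> \<chi> \<and>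
      sgrp_isomorphic (cc_semigroup D C \<Gamma> \<Delta> \<chi>) (rees_matrix G Y X P))"
  using cross_connection_conn is_dual_conn is_duality_chi cc_semigroup_conn_iso_rees by blast

end


section \<open>The ideal categories of a Rees matrix semigroup\<close>

definition opposite_group :: "'g monoid \<Rightarrow> 'g monoid" where
  "opposite_group G = \<lparr>carrier = carrier G, mult = (\<lambda>a b. b \<otimes>\<^bsub>G\<^esub> a), one = \<one>\<^bsub>G\<^esub>\<rparr>"

lemma opposite_group_simps [simp]:
  "carrier (opposite_group G) = carrier G"
  "a \<otimes>\<^bsub>opposite_group G\<^esub> b = b \<otimes>\<^bsub>G\<^esub> a"
  "\<one>\<^bsub>opposite_group G\<^esub> = \<one>\<^bsub>G\<^esub>"
  by (simp_all add: opposite_group_def)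

lemma group_opposite_group:
  fixes G (structure)
  assumes "group G"
  shows "group (opposite_group G)"
proof -
  interpret group G by fact
  show ?thesis
    by (rule groupI) (auto simp: m_assoc intro: r_inv)
qed

text \<open>Covers both kinds of ideals: \<open>act g y\<close> is the map with label
  \<open>g\<close> into \<open>A y\<close>. Labels are recovered by evaluating at one point, and
  since no ideal contains another, inclusions are identities.\<close>

lemma concrete_cat_coordinatized:
  fixes G (structure) and A :: "'x \<Rightarrow> 'a set" and act :: "'g \<Rightarrow> 'x \<Rightarrow> 'a \<Rightarrow> 'a"
  assumes "group G" and X: "X \<noteq> {}"
    and ar: "\<And>x g y. ar x g y = (A x, \<lambda>v\<in>A x. act g y v, A y)"
    and A: "\<And>x y. A x \<subseteq> A y \<Longrightarrow> x = y"
    and act_closed: "\<And>x y g v. \<lbrakk>v \<in> A x; g \<in> carrier G\<rbrakk> \<Longrightarrow> act g y v \<in> A y"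
    and act_mult: "\<And>x y z g h v. \<lbrakk>v \<in> A x; g \<in> carrier G; h \<in> carrier G\<rbrakk> \<Longrightarrow>
      act h z (act g y v) = act (g \<otimes> h) z v"
    and act_one: "\<And>x v. v \<in> A x \<Longrightarrow> act \<one> x v = v"
    and act_inj: "\<And>x y. \<exists>v\<in>A x. inj_on (\<lambda>g. act g y v) (carrier G)"
  shows "coordinatized_groupoid G
    (concrete_cat (A ` X) {ar x g y | x g y. x \<in> X \<and> g \<in> carrier G \<and> y \<in> X}) X A ar"
    (is "coordinatized_groupoid G ?C X A ar")
proof -
  interpret group G by fact
  have ar_inj: "g = h"
    if "g \<in> carrier G" "h \<in> carrier G" "ar x g y = ar x h y" for x y g h
  proof -
    obtain v where v: "v \<in> A x" "inj_on (\<lambda>g. act g y v) (carrier G)"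
      using act_inj by blast
    have "fst (snd (ar x g y)) v = fst (snd (ar x h y)) v"
      using that by simp
    then have "act g y v = act h y v"
      using v by (simp add: ar)
    then show ?thesis
      using inj_onD[OF v(2)] that by simp
  qed
  have one: "ar x \<one> x = (A x, \<lambda>v\<in>A x. v, A x)" for x
    by (auto simp: ar act_one intro!: restrict_ext)
  show ?thesis
  proof unfold_locales
    show "inj_on A X"
      by (rule inj_onI) (simp add: A)
    show "Cmp ?C (ar x g y) (ar y h z) = ar x (g \<otimes> h) z"
      if "g \<in> carrier G" "h \<in> carrier G" for x y z g h
      using that
      by (auto simp: concrete_cat_def ar compose_def act_closed act_mult intro!: restrict_ext)
    show "Idt ?C (A x) = ar x \<one> x" for x
      by (simp add: one concrete_cat_def)
    show "Inc ?C = (\<lambda>x. ar x \<one> x) ` X"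
    proof (intro equalityI subsetI)
      fix j assume "j \<in> Inc ?C"
      then obtain x g y where j: "j = ar x g y" "x \<in> X" "g \<in> carrier G"
        and "A x \<subseteq> A y" and f: "j = (A x, \<lambda>v\<in>A x. v, A y)"
        by (auto simp: concrete_cat_def ar)
      then have "x = y"
        by (intro A)
      with j f have "ar x g x = ar x \<one> x"
        by (simp add: one)
      then have "g = \<one>"
        using j by (intro ar_inj) auto
      then show "j \<in> (\<lambda>x. ar x \<one> x) ` X"
        using j \<open>x = y\<close> by simp
    next
      fix j assume "j \<in> (\<lambda>x. ar x \<one> x) ` X"
      then obtain x where x: "x \<in> X" "j = ar x \<one> x"
        by blast
      then have "\<exists>x g y. j = ar x g y \<and> x \<in> X \<and> g \<in> carrier G \<and> y \<in> X"
        by blast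
      then show "j \<in> Inc ?C"
        by (simp add: concrete_cat_def x(2) one)
    qed
  qed (use X ar_inj in \<open>auto simp: concrete_cat_def ar\<close>)
qed

lemma left_ideal_cat_coordinatized:
  fixes G (structure)
  assumes "group G" and I: "I \<noteq> {}" and \<Lambda>: "\<Lambda> \<noteq> {}"
  shows "coordinatized_groupoid G (left_ideal_cat G I \<Lambda>) \<Lambda> (left_ideal G I) (rho G I)"
proof -
  interpret group G by fact
  \<comment> \<open>With \<open>I\<close> empty all left ideals would be empty; the element (1,i,l)
    distinguishes them and, evaluated, returns the label.\<close>
  obtain i where i: "i \<in> I"
    using I by blast
  show ?thesis
    unfolding left_ideal_cat_def
  proof (rule concrete_cat_coordinatized[where act = "\<lambda>g m (h, i, l). (h \<otimes> g, i, m)"])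
    show "\<exists>v\<in>left_ideal G I l. inj_on (\<lambda>g. (\<lambda>(h, i, l). (h \<otimes> g, i, m)) v) (carrier G)" for l m
      by (rule bexI[of _ "(\<one>, i, l)"]) (use i in \<open>auto simp: left_ideal_def inj_on_def\<close>)
    show "l = m" if "left_ideal G I l \<subseteq> left_ideal G I m" for l m
      using subsetD[OF that, of "(\<one>, i, l)"] i by (simp add: left_ideal_def)
  qed (use \<Lambda> in \<open>auto simp: rho_def left_ideal_def m_assoc\<close>)
qed

text \<open>Labels multiply from the left, so applying g and then h multiplies by h g, the product
  of g and h in the opposite group.\<close>

lemma right_ideal_cat_coordinatized:
  fixes G (structure)
  assumes "group G" and I: "I \<noteq> {}" and \<Lambda>: "\<Lambda> \<noteq> {}"
  shows "coordinatized_groupoid (opposite_group G) (right_ideal_cat G I \<Lambda>) I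
    (right_ideal G \<Lambda>) (kappa G \<Lambda>)"
proof -
  interpret group G by fact
  obtain l where l: "l \<in> \<Lambda>"
    using \<Lambda> by blast
  have "coordinatized_groupoid (opposite_group G)
    (concrete_cat (right_ideal G \<Lambda> ` I)
      {kappa G \<Lambda> i g j | i g j. i \<in> I \<and> g \<in> carrier (opposite_group G) \<and> j \<in> I})
    I (right_ideal G \<Lambda>) (kappa G \<Lambda>)"
  proof (rule concrete_cat_coordinatized[where act = "\<lambda>g j (h, i, l). (g \<otimes> h, j, l)"])
    show "group (opposite_group G)"
      by (rule group_opposite_group) fact
    show "\<exists>v\<in>right_ideal G \<Lambda> i. inj_on (\<lambda>g. (\<lambda>(h, i, l). (g \<otimes> h, j, l)) v)
        (carrier (opposite_group G))" for i j
      by (rule bexI[of _ "(\<one>, i, l)"]) (use l in \<open>auto simp: right_ideal_def inj_on_def\<close>)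
    show "i = j" if "right_ideal G \<Lambda> i \<subseteq> right_ideal G \<Lambda> j" for i j
      using subsetD[OF that, of "(\<one>, i, l)"] l by (simp add: right_ideal_def)
  qed (use I in \<open>auto simp: kappa_def right_ideal_def m_assoc\<close>)
  then show ?thesis
    by (simp add: right_ideal_cat_def)
qed

theorem theorem34:
  fixes G :: "'g monoid" and I :: "'i set" and \<Lambda> :: "'l set" and P :: "'l \<Rightarrow> 'i \<Rightarrow> 'g"
  assumes "group G"
    and "I \<noteq> {}" and "\<Lambda> \<noteq> {}"
    and "\<And>l i. l \<in> \<Lambda> \<Longrightarrow> i \<in> I \<Longrightarrow> P l i \<in> carrier G"
  shows "\<exists>\<Gamma>. cross_connection (right_ideal_cat G I \<Lambda>) (left_ideal_cat G I \<Lambda>) \<Gamma> \<and>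
    (\<exists>\<Delta> \<chi>. is_dual (right_ideal_cat G I \<Lambda>) (left_ideal_cat G I \<Lambda>) \<Gamma> \<Delta> \<and>
           is_duality (right_ideal_cat G I \<Lambda>) (left_ideal_cat G I \<Lambda>) \<Gamma> \<Delta> \<chi> \<and>
           sgrp_isomorphic
             (cc_semigroup (right_ideal_cat G I \<Lambda>) (left_ideal_cat G I \<Lambda>) \<Gamma> \<Delta> \<chi>)
             (rees_matrix G I \<Lambda> P))"
proof -
  interpret matrix_connection G "left_ideal_cat G I \<Lambda>" \<Lambda> "left_ideal G I" "rho G I"
    "opposite_group G" "right_ideal_cat G I \<Lambda>" I "right_ideal G \<Lambda>" "kappa G \<Lambda>" P
    using assms
    by (intro matrix_connection.intro left_ideal_cat_coordinatized right_ideal_cat_coordinatized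
        matrix_connection_axioms.intro) auto
  show ?thesis
    by (rule ex_cross_connection_rees)
qed

end
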